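(* Let $n\in\mathbb{N}$. A preference vector $\alpha=(\alpha_1,\alpha_2,\ldots,\alpha_n)\in[n]^n$ satisfies $\alpha\in \mathrm{PF}_n(\mathrm{id})$ if and only if its entries satisfy $\alpha_i\le i$ for all $i\in[n]$.
   Context: $[n]=\{1,2,\dots,n\}$. Classical parking protocol: given $\alpha\in[n]^n$, cars $1,2,\dots,n$ arrive in this order at a one-way street with spots $1,\dots,n$. Car $i$ first tries spot $\alpha_i$; if it is unoccupied the car parks there; otherwise the car parks in the first unoccupied spot to the right of $\alpha_i$ (i.e. with larger number), and if there is none it leaves without parking. $\alpha$ is a parking function of length $n$ if all $n$ cars park. $\mathrm{PF}_n(\mathrm{id})$ is the set of parking functions $\alpha$ of length $n$ whose outcome is the identity permutation, i.e. for which car $i$ parks in spot $i$ for every $i\in[n]$. *)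

theory Defs
  imports "HOL-Library.FuncSet"
begin

text \<open>Vectors in \<open>[n]^n\<close> are extensional functions on \<open>{1..n}\<close>, so that indices start at 1.\<close>

definition preference_vectors :: "nat \<Rightarrow> (nat \<Rightarrow> nat) set" where
  "preference_vectors n = {1..n} \<rightarrow>\<^sub>E {1..n}"

text \<open>The spot taken by a car with preference \<open>a\<close> on a street with spots \<open>{1..n}\<close> whose
  occupied spots are \<open>S\<close>; \<open>None\<close> means that the car leaves without parking.\<close>

definition park :: "nat \<Rightarrow> nat set \<Rightarrow> nat \<Rightarrow> nat option" where
  "park n S a =
    (if a \<notin> S then Some a
     else if {a<..n} - S \<noteq> {} then Some (Min ({a<..n} - S))
     else None)"

text \<open>The spots occupied once the cars \<open>1, \<dots>, i\<close> have arrived.\<close>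

primrec occupied :: "nat \<Rightarrow> (nat \<Rightarrow> nat) \<Rightarrow> nat \<Rightarrow> nat set" where
  "occupied n \<alpha> 0 = {}"
| "occupied n \<alpha> (Suc i) =
     occupied n \<alpha> i \<union> set_option (park n (occupied n \<alpha> i) (\<alpha> (Suc i)))"

text \<open>The spot of car \<open>i\<close>, for \<open>i \<ge> 1\<close>.\<close>

definition spot_of :: "nat \<Rightarrow> (nat \<Rightarrow> nat) \<Rightarrow> nat \<Rightarrow> nat option" where
  "spot_of n \<alpha> i = park n (occupied n \<alpha> (i - 1)) (\<alpha> i)"

definition PF :: "nat \<Rightarrow> (nat \<Rightarrow> nat) set" where
  "PF n = {\<alpha> \<in> preference_vectors n. \<forall>i\<in>{1..n}. spot_of n \<alpha> i \<noteq> None}"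

definition PF_id :: "nat \<Rightarrow> (nat \<Rightarrow> nat) set" where
  "PF_id n = {\<alpha> \<in> PF n. \<forall>i\<in>{1..n}. spot_of n \<alpha> i = Some i}"

end

theory Submission
  imports Defs
begin

text \<open>
  A car only ever moves to the right, so it never parks before the spot it prefers
  (\<open>park_ge\<close>). Hence, if car \<open>i\<close> parks in spot \<open>i\<close>, then \<open>\<alpha> i \<le> i\<close>.

  Conversely, suppose that \<open>\<alpha> i \<le> i\<close> for all \<open>i\<close>. The cars then fill the street from the left
  without gaps: when car \<open>i + 1\<close> arrives, exactly the spots \<open>1, \<dots>, i\<close> are taken
  (\<open>occupied_initial_segment\<close>). Its preference is either the free spot \<open>i + 1\<close> itself or a
  spot inside the occupied block, and in both cases the first free spot that it meets
  is \<open>i + 1\<close> (\<open>park_initial_segment\<close>).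
\<close>

lemma park_ge:
  assumes "park n S a = Some s"
  shows "a \<le> s"
proof (cases "a \<in> S")
  case True
  with assms have ne: "{a<..n} - S \<noteq> {}" and s: "s = Min ({a<..n} - S)"
    by (auto simp: park_def split: if_splits)
  from ne have "s \<in> {a<..n} - S"
    unfolding s by (intro Min_in) simp_all
  then show ?thesis by simp
qed (use assms in \<open>simp add: park_def\<close>)

lemma park_initial_segment:
  assumes "1 \<le> a" "a \<le> Suc i" "Suc i \<le> n"
  shows "park n {1..i} a = Some (Suc i)"
proof (cases "a = Suc i")
  case False
  with assms have "a \<in> {1..i}" and "{a<..n} - {1..i} = {Suc i..n}"
    by auto
  moreover have "Min {Suc i..n} = Suc i"
    using assms by (intro Min_eqI) auto
  ultimately show ?thesis
    using assms by (simp add: park_def)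
qed (simp add: park_def)

text \<open>
  The bound \<open>\<alpha> j \<le> j\<close> keeps the occupied block free of gaps: a car that preferred a spot
  beyond \<open>j\<close> would leave spot \<open>j\<close> empty behind it.
\<close>

lemma occupied_initial_segment:
  assumes "\<And>j. j \<in> {1..i} \<Longrightarrow> 1 \<le> \<alpha> j \<and> \<alpha> j \<le> j" and "i \<le> n"
  shows "occupied n \<alpha> i = {1..i}"
  using assms
proof (induction i)
  case (Suc i)
  then have "occupied n \<alpha> i = {1..i}"
    by simp
  moreover have "park n {1..i} (\<alpha> (Suc i)) = Some (Suc i)"
    using Suc.prems by (intro park_initial_segment) auto
  ultimately show ?case
    by (simp add: atLeastAtMostSuc_conv)
qed simp

theorem lemma1p3:
  fixes n :: nat and \<alpha> :: "nat \<Rightarrow> nat"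
  assumes "\<alpha> \<in> preference_vectors n"
  shows "\<alpha> \<in> PF_id n \<longleftrightarrow> (\<forall>i\<in>{1..n}. \<alpha> i \<le> i)"
proof
  assume "\<alpha> \<in> PF_id n"
  then show "\<forall>i\<in>{1..n}. \<alpha> i \<le> i"
    by (auto simp: PF_id_def spot_of_def intro: park_ge)
next
  assume le: "\<forall>i\<in>{1..n}. \<alpha> i \<le> i"
  have ge: "1 \<le> \<alpha> i" if "i \<in> {1..n}" for i
    using assms that by (auto simp: preference_vectors_def dest: PiE_mem)
  have "spot_of n \<alpha> i = Some i" if i: "i \<in> {1..n}" for i
  proof -
    have "occupied n \<alpha> (i - 1) = {1..i - 1}"
      using i le ge by (intro occupied_initial_segment) auto
    moreover have "park n {1..i - 1} (\<alpha> i) = Some (Suc (i - 1))"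
      using i le ge by (intro park_initial_segment) auto
    ultimately show ?thesis
      using i by (simp add: spot_of_def)
  qed
  then show "\<alpha> \<in> PF_id n"
    using assms by (simp add: PF_id_def PF_def)
qed

end
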